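(* There exist a compact metric space $X$ and a distal homeomorphism $f:X\to X$ such that $f$ has the almost POTP but does not have the pseudo-orbit tracing property (POTP).
   Context: Let $f:X\to X$ be a homeomorphism of a metric space $(X,d)$. For $\delta>0$, a bi-infinite sequence $\xi=(\xi_n)_{n\in\mathbb{Z}}$ of points of $X$ is a $\delta$-pseudo-orbit if $d(f(\xi_n),\xi_{n+1})\leq\delta$ for all $n\in\mathbb{Z}$. For $\epsilon>0$, $\xi$ can be $\epsilon$-shadowed if there is $x\in X$ such that $d(f^n(x),\xi_n)\leq\epsilon$ for all $n\in\mathbb{Z}$. $f$ has the POTP if for every $\epsilon>0$ there is $\delta>0$ such that every $\delta$-pseudo-orbit can be $\epsilon$-shadowed. A point $x\in X$ is shadowable if for every $\epsilon>0$ there is $\delta>0$ such that every $\delta$-pseudo-orbit $\xi$ with $\xi_0=x$ can be $\epsilon$-shadowed. $f$ has the almost POTP if the set $Sh(f)$ of shadowable points of $f$ is dense in $X$. The homeomorphism $f$ is distal if $\inf_{n\in\mathbb{Z}}d(f^n(x),f^n(y))>0$ for all distinct points $x,y\in X$. *)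

theory Defs
  imports "HOL-Analysis.Analysis"
begin

text \<open>
  A metric space is given, as in the library locale \<^locale>\<open>Metric_space\<close>, by a carrier \<open>M\<close> and
  a distance \<open>d\<close>; maps of \<open>M\<close> are total functions whose values outside \<open>M\<close> are irrelevant.
  Existence of a compact metric space may be stated with \<open>M :: real set\<close> and an arbitrary metric
  \<open>d\<close>: a compact metric space has at most continuum many points, so up to isometry it is of this form.
\<close>

text \<open>The iterate \<open>f\<^sup>n\<close>, \<open>n \<in> \<int>\<close>, of a bijection \<open>f\<close> of \<open>M\<close> onto itself; for \<open>n < 0\<close> it is the
  \<open>(-n)\<close>-th iterate of the inverse of \<open>f\<close> on \<open>M\<close>.\<close>

definition int_iterate :: "'a set \<Rightarrow> ('a \<Rightarrow> 'a) \<Rightarrow> int \<Rightarrow> 'a \<Rightarrow> 'a" where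
  "int_iterate M f n = (if n \<ge> 0 then f ^^ nat n else inv_into M f ^^ nat (- n))"

definition pseudo_orbit ::
    "'a set \<Rightarrow> ('a \<Rightarrow> 'a \<Rightarrow> real) \<Rightarrow> ('a \<Rightarrow> 'a) \<Rightarrow> real \<Rightarrow> (int \<Rightarrow> 'a) \<Rightarrow> bool" where
  "pseudo_orbit M d f \<delta> \<xi> \<longleftrightarrow> (\<forall>n. \<xi> n \<in> M) \<and> (\<forall>n. d (f (\<xi> n)) (\<xi> (n + 1)) \<le> \<delta>)"

definition can_be_shadowed ::
    "'a set \<Rightarrow> ('a \<Rightarrow> 'a \<Rightarrow> real) \<Rightarrow> ('a \<Rightarrow> 'a) \<Rightarrow> real \<Rightarrow> (int \<Rightarrow> 'a) \<Rightarrow> bool" where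
  "can_be_shadowed M d f \<epsilon> \<xi> \<longleftrightarrow> (\<exists>x\<in>M. \<forall>n. d (int_iterate M f n x) (\<xi> n) \<le> \<epsilon>)"

definition POTP :: "'a set \<Rightarrow> ('a \<Rightarrow> 'a \<Rightarrow> real) \<Rightarrow> ('a \<Rightarrow> 'a) \<Rightarrow> bool" where
  "POTP M d f \<longleftrightarrow>
    (\<forall>\<epsilon>>0. \<exists>\<delta>>0. \<forall>\<xi>. pseudo_orbit M d f \<delta> \<xi> \<longrightarrow> can_be_shadowed M d f \<epsilon> \<xi>)"

definition shadowable_points :: "'a set \<Rightarrow> ('a \<Rightarrow> 'a \<Rightarrow> real) \<Rightarrow> ('a \<Rightarrow> 'a) \<Rightarrow> 'a set" where
  "shadowable_points M d f =
    {x \<in> M. \<forall>\<epsilon>>0. \<exists>\<delta>>0. \<forall>\<xi>. pseudo_orbit M d f \<delta> \<xi> \<and> \<xi> 0 = x \<longrightarrow> can_be_shadowed M d f \<epsilon> \<xi>}"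

definition almost_POTP :: "'a set \<Rightarrow> ('a \<Rightarrow> 'a \<Rightarrow> real) \<Rightarrow> ('a \<Rightarrow> 'a) \<Rightarrow> bool" where
  "almost_POTP M d f \<longleftrightarrow>
    Metric_space.mtopology M d closure_of shadowable_points M d f = M"

definition distal :: "'a set \<Rightarrow> ('a \<Rightarrow> 'a \<Rightarrow> real) \<Rightarrow> ('a \<Rightarrow> 'a) \<Rightarrow> bool" where
  "distal M d f \<longleftrightarrow>
    (\<forall>x\<in>M. \<forall>y\<in>M. x \<noteq> y \<longrightarrow> (INF n::int. d (int_iterate M f n x) (int_iterate M f n y)) > 0)"

end

theory Submission
  imports Defs
begin

text \<open>
  The identity map of a compact metric space is distal, so it is enough to find a space whose
  identity map is almost, but not fully, pseudo-orbit tracing. A small-step pseudo-orbit of the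
  identity is a chain of points with small jumps, and its shadowing orbit is a single point.
  Hence an isolated point is shadowable: a chain through it with jumps shorter than the isolation
  radius never leaves it (\<open>isolated_imp_shadowable_id\<close>). A nonconstant path, on the other hand,
  destroys the POTP: one can creep along it by arbitrarily small jumps from one end to the other,
  and no single point is close to both ends (\<open>path_imp_not_POTP_id\<close>).

  It remains to exhibit a compact space that contains a segment and has a dense set of isolated
  points. The planar set \<open>grid\<close> consists of the segment \<open>[0,1] \<times> {0}\<close> together with the points
  \<open>(k/m, 1/m)\<close>, \<open>0 \<le> k \<le> m\<close>, \<open>m \<ge> 1\<close>: these are isolated, and their rows accumulate exactly on the segment.
  Every point \<open>(x, y)\<close> of \<open>grid\<close> is determined by the real number \<open>x + 2/y\<close>, so the example can be
  carried over to a set of reals by pulling back the Euclidean metric.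
\<close>

section \<open>The identity map as a dynamical system\<close>

lemma inv_into_id_funpow:
  assumes "x \<in> M"
  shows "(inv_into M id ^^ k) x = x"
proof (induction k)
  case (Suc k)
  have "inv_into M id x = x"
    using inv_into_f_f[of id M x] assms by simp
  with Suc show ?case by (simp del: id_apply)
qed simp

lemma int_iterate_id: "x \<in> M \<Longrightarrow> int_iterate M id n x = x"
  by (simp add: int_iterate_def inv_into_id_funpow)

lemma (in Metric_space) distal_id: "distal M d id"
  by (auto simp: distal_def int_iterate_id)

text \<open>
  Below the isolation radius, symmetry of the metric lets the argument run in both directions of
  time: neither a successor nor a predecessor of the isolated point can differ from it.
\<close>

lemma (in Metric_space) isolated_imp_shadowable_id:
  assumes x: "x \<in> M" and r: "r > 0" and isolated: "\<And>y. y \<in> M \<Longrightarrow> d x y \<le> r \<Longrightarrow> y = x"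
  shows "x \<in> shadowable_points M d id"
proof -
  have "can_be_shadowed M d id \<epsilon> \<xi>"
    if "\<epsilon> > 0" and \<xi>: "pseudo_orbit M d id r \<xi>" "\<xi> 0 = x" for \<epsilon> \<xi>
  proof -
    have inM: "\<xi> n \<in> M" and jump: "d (\<xi> n) (\<xi> (n + 1)) \<le> r" for n
      using \<xi>(1) by (auto simp: pseudo_orbit_def)
    have "\<xi> n = x" for n
    proof (induction n rule: int_induct[where k = 0])
      case (step1 i)
      then show ?case using isolated[OF inM] jump[of i] by simp
    next
      case (step2 i)
      then show ?case using isolated[OF inM] jump[of "i - 1"] commute by simp
    qed (use \<xi>(2) in simp)
    then show ?thesis
      using x \<open>\<epsilon> > 0\<close> by (auto simp: can_be_shadowed_def int_iterate_id intro!: bexI[of _ x])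
  qed
  then show ?thesis
    using x r unfolding shadowable_points_def by blast
qed

lemma (in Metric_space) path_imp_not_POTP_id:
  fixes \<gamma> :: "real \<Rightarrow> 'a"
  assumes path: "\<gamma> ` {0..1} \<subseteq> M"
    and unif: "\<And>\<delta>. \<delta> > 0 \<Longrightarrow>
      \<exists>\<eta>>0. \<forall>s\<in>{0..1}. \<forall>t\<in>{0..1}. \<bar>s - t\<bar> \<le> \<eta> \<longrightarrow> d (\<gamma> s) (\<gamma> t) \<le> \<delta>"
    and ends: "\<gamma> 0 \<noteq> \<gamma> 1"
  shows "\<not> POTP M d id"
proof
  assume POTP: "POTP M d id"
  define D where "D = d (\<gamma> 0) (\<gamma> 1)"
  have M01: "\<gamma> 0 \<in> M" "\<gamma> 1 \<in> M" using path by auto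
  then have "D > 0" using ends by (simp add: D_def)
  then have "D / 3 > 0" by simp
  then obtain \<delta> where "\<delta> > 0"
    and \<delta>: "\<And>\<xi>. pseudo_orbit M d id \<delta> \<xi> \<Longrightarrow> can_be_shadowed M d id (D / 3) \<xi>"
    using POTP unfolding POTP_def by blast
  obtain \<eta> where "\<eta> > 0"
    and \<eta>: "\<And>s t. s \<in> {0..1} \<Longrightarrow> t \<in> {0..1} \<Longrightarrow> \<bar>s - t\<bar> \<le> \<eta> \<Longrightarrow> d (\<gamma> s) (\<gamma> t) \<le> \<delta>"
    using unif[OF \<open>\<delta> > 0\<close>] by blast
  \<comment> \<open>Rest at the start until time 0, walk along the path at speed \<open>\<eta>\<close>, then rest at the end.\<close>
  define time where "time n = max 0 (min 1 (\<eta> * real_of_int n))" for n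
  have time: "time n \<in> {0..1}" for n by (auto simp: time_def)
  have "\<bar>time n - time (n + 1)\<bar> \<le> \<eta>" for n
    using \<open>\<eta> > 0\<close> by (auto simp: time_def algebra_simps)
  then have "pseudo_orbit M d id \<delta> (\<lambda>n. \<gamma> (time n))"
    unfolding pseudo_orbit_def using path time \<eta> by auto
  then obtain x where x: "x \<in> M" and near: "\<And>n. d x (\<gamma> (time n)) \<le> D / 3"
    using \<delta> unfolding can_be_shadowed_def by (force simp: int_iterate_id)
  obtain N :: nat where "1 / \<eta> < real N" using reals_Archimedean2 by blast
  then have "time (int N) = 1" "time 0 = 0"
    using \<open>\<eta> > 0\<close> by (auto simp: time_def field_simps)
  then have "d x (\<gamma> 0) \<le> D / 3" "d x (\<gamma> 1) \<le> D / 3"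
    using near[of 0] near[of "int N"] by auto
  moreover have "D \<le> d x (\<gamma> 0) + d x (\<gamma> 1)"
    using triangle[OF M01(1) x M01(2)] commute by (simp add: D_def)
  ultimately show False using \<open>D > 0\<close> by simp
qed

section \<open>Pulling back a metric along an injection\<close>

lemma Metric_space_pullback:
  fixes g :: "'a \<Rightarrow> 'b::metric_space"
  assumes "inj_on g X"
  shows "Metric_space X (\<lambda>s t. dist (g s) (g t))"
  using assms by unfold_locales (auto simp: dist_commute dist_triangle inj_on_def)

lemma compact_space_pullback:
  fixes g :: "'a \<Rightarrow> 'b::metric_space"
  assumes inj: "inj_on g X" and compact: "compact (g ` X)"
  shows "compact_space (Metric_space.mtopology X (\<lambda>s t. dist (g s) (g t)))"
proof -
  interpret Metric_space X "\<lambda>s t. dist (g s) (g t)"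
    by (rule Metric_space_pullback[OF inj])
  show ?thesis
    unfolding compact_space_sequentially
  proof (intro strip)
    fix \<sigma> :: "nat \<Rightarrow> 'a"
    assume \<sigma>: "range \<sigma> \<subseteq> X"
    then have "\<forall>n. (g \<circ> \<sigma>) n \<in> g ` X" by auto
    then obtain l r where "l \<in> X" "strict_mono r" and lim: "(g \<circ> \<sigma> \<circ> r) \<longlonglongrightarrow> g l"
      using compact unfolding compact_def by blast
    have "limitin mtopology (\<sigma> \<circ> r) l sequentially"
      unfolding limitin_metric
    proof (intro conjI allI impI)
      fix e :: real assume "e > 0"
      show "\<forall>\<^sub>F n in sequentially. (\<sigma> \<circ> r) n \<in> X \<and> dist (g ((\<sigma> \<circ> r) n)) (g l) < e"
        using tendstoD[OF lim \<open>e > 0\<close>] by eventually_elim (use \<sigma> in auto)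
    qed (rule \<open>l \<in> X\<close>)
    then show "\<exists>l r. l \<in> X \<and> strict_mono r \<and> limitin mtopology (\<sigma> \<circ> r) l sequentially"
      using \<open>l \<in> X\<close> \<open>strict_mono r\<close> by blast
  qed
qed

section \<open>A segment approximated by finer and finer grids\<close>

text \<open>
  The row \<open>m = 0\<close> is the segment \<open>[0,1] \<times> {0}\<close>: since \<open>1/0 = 0\<close>, it lies at height 0, and the
  condition \<open>x * 0 \<in> \<int>\<close> holds for every \<open>x\<close>. Row \<open>m > 0\<close> is the grid of mesh \<open>1/m\<close> at height \<open>1/m\<close>.
\<close>

definition grid :: "(real \<times> real) set" where
  "grid = {(x, 1 / real m) | x m. 0 \<le> x \<and> x \<le> 1 \<and> x * real m \<in> \<int>}"

definition grid_rows :: "nat \<Rightarrow> (real \<times> real) set" where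
  "grid_rows N = {(x, 1 / real m) | x m. 0 \<le> x \<and> x \<le> 1 \<and> x * real m \<in> \<int> \<and> 1 \<le> m \<and> m \<le> N}"

lemma finite_grid_rows: "finite (grid_rows N)"
proof (rule finite_subset)
  show "grid_rows N \<subseteq> (\<lambda>(k, m). (real_of_int k / real m, 1 / real m)) ` ({0..int N} \<times> {1..N})"
  proof
    fix p assume "p \<in> grid_rows N"
    then obtain x m where p: "p = (x, 1 / real m)" and x: "0 \<le> x" "x \<le> 1" "x * real m \<in> \<int>"
      and m: "1 \<le> m" "m \<le> N"
      by (auto simp: grid_rows_def)
    obtain k where k: "x * real m = of_int k" using x(3) by (auto elim: Ints_cases)
    have "0 \<le> x * real m" "x * real m \<le> real m" using x by (auto intro: mult_left_le_one_le)
    then have "0 \<le> k" "k \<le> int N" using k m by linarith+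
    moreover have "x = of_int k / real m" using k m by (simp add: field_simps)
    ultimately show "p \<in> (\<lambda>(k, m). (real_of_int k / real m, 1 / real m)) ` ({0..int N} \<times> {1..N})"
      using p m by (auto intro!: image_eqI[of _ _ "(k, m)"])
  qed
qed auto

text \<open>
  All rows but finitely many lie in any given strip along the segment. So the grid is the
  intersection of compact sets, each a thin strip together with finitely many finite rows.
\<close>

lemma compact_grid: "compact grid"
proof -
  define C where "C N = {0..1} \<times> {0..1 / real (Suc N)} \<union> grid_rows (Suc N)" for N
  have "grid = (\<Inter>N. C N)"
  proof (intro equalityI subsetI)
    fix p assume "p \<in> grid"
    then obtain x m where p: "p = (x, 1 / real m)" and x: "0 \<le> x" "x \<le> 1" "x * real m \<in> \<int>"
      by (auto simp: grid_def)
    have "p \<in> C N" for N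
    proof (cases "1 \<le> m \<and> m \<le> Suc N")
      case True
      then show ?thesis using p x by (auto simp: C_def grid_rows_def)
    next
      case False
      then have "m = 0 \<or> Suc N < m" by auto
      then have "1 / real m \<le> 1 / real (Suc N)"
      proof
        assume "Suc N < m"
        then show ?thesis by (intro divide_left_mono) auto
      qed simp
      then show ?thesis using p x by (auto simp: C_def)
    qed
    then show "p \<in> (\<Inter>N. C N)" by blast
  next
    fix p assume p: "p \<in> (\<Inter>N. C N)"
    show "p \<in> grid"
    proof (cases "\<exists>N. p \<in> grid_rows N")
      case True
      then show ?thesis by (auto simp: grid_rows_def grid_def)
    next
      case False
      obtain x y where xy: "p = (x, y)" by fastforce
      have strip: "x \<in> {0..1}" "0 \<le> y" "y \<le> 1 / real (Suc N)" for N
        using p False by (auto simp: C_def xy)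
      have "y = 0"
      proof (rule ccontr)
        assume "y \<noteq> 0"
        then have "y > 0" using strip(2) by simp
        then obtain N where "1 / real (Suc N) < y" using nat_approx_posE by blast
        then show False using strip(3)[of N] by simp
      qed
      then show ?thesis using strip(1) xy by (auto simp: grid_def intro!: exI[of _ "0::nat"])
    qed
  qed
  moreover have "compact (C N)" for N
    unfolding C_def
    by (intro compact_Un compact_Times compact_Icc finite_imp_compact[OF finite_grid_rows])
  ultimately show ?thesis
    using compact_Inter[of "range C"] by auto
qed

text \<open>Near a point at height \<open>1/m > 0\<close> only the finitely many points in the rows up to \<open>2 m\<close> occur.\<close>

lemma grid_isolated:
  assumes p: "p \<in> grid" "snd p > 0"
  shows "\<exists>r>0. \<forall>q\<in>grid. dist p q \<le> r \<longrightarrow> q = p"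
proof -
  obtain x m where p_eq: "p = (x, 1 / real m)" using p by (auto simp: grid_def)
  then have m: "m > 0" using p by (cases m) auto
  obtain a where "a > 0" and a: "\<And>q. q \<in> grid_rows (2 * m) \<Longrightarrow> q \<noteq> p \<Longrightarrow> a \<le> dist p q"
    using finite_set_avoid[OF finite_grid_rows] by metis
  define r where "r = min (a / 2) (1 / (4 * real m))"
  have "q = p" if q: "q \<in> grid" "dist p q \<le> r" for q
  proof -
    obtain x' m' where q_eq: "q = (x', 1 / real m')"
      and x': "0 \<le> x'" "x' \<le> 1" "x' * real m' \<in> \<int>"
      using q by (auto simp: grid_def)
    have "\<bar>1 / real m - 1 / real m'\<bar> \<le> 1 / (4 * real m)"
      using dist_snd_le[of p q] q by (simp add: p_eq q_eq dist_real_def r_def)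
    moreover have "1 / (2 * real m) + 1 / (4 * real m) < 1 / real m"
      using m by (simp add: field_simps)
    ultimately have lt: "1 / (2 * real m) < 1 / real m'" by linarith
    then have "m' > 0" by (cases m') auto
    with lt m have "m' < 2 * m" by (simp add: field_simps flip: of_nat_mult)
    then have "q \<in> grid_rows (2 * m)"
      using x' \<open>m' > 0\<close> by (auto simp: q_eq grid_rows_def)
    moreover have "dist p q < a" using q \<open>a > 0\<close> by (simp add: r_def)
    ultimately show ?thesis using a[of q] by (meson not_le)
  qed
  moreover have "r > 0" using \<open>a > 0\<close> m by (simp add: r_def)
  ultimately show ?thesis by blast
qed

text \<open>A point of the segment is approximated in row \<open>n\<close> by rounding its abscissa down to a multiple of \<open>1/n\<close>.\<close>

lemma grid_positive_height_dense:
  assumes p: "p \<in> grid" and r: "r > 0"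
  shows "\<exists>q\<in>grid. snd q > 0 \<and> dist p q < r"
proof (cases "snd p > 0")
  case True
  then show ?thesis using p r by (intro bexI[of _ p]) auto
next
  case False
  from p obtain x m where "p = (x, 1 / real m)" and x: "0 \<le> x" "x \<le> 1"
    by (auto simp: grid_def)
  with False have p_eq: "p = (x, 0)" by (cases m) auto
  obtain n :: nat where large: "2 / r < real n"
    using reals_Archimedean2 by blast
  moreover have "0 < 2 / r" using r by simp
  ultimately have "n > 0" by linarith
  with large r have n: "2 / real n < r" by (simp add: field_simps)
  define x' where "x' = of_int \<lfloor>x * real n\<rfloor> / real n"
  define q where "q = (x', 1 / real n)"
  have floor: "of_int \<lfloor>x * real n\<rfloor> \<le> x * real n" "x * real n < of_int \<lfloor>x * real n\<rfloor> + 1"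
    by linarith+
  have "x' * real n = of_int \<lfloor>x * real n\<rfloor>"
    using \<open>n > 0\<close> by (simp add: x'_def)
  with floor have "x' * real n \<le> x * real n" "(x - x') * real n \<le> 1"
    unfolding left_diff_distrib by linarith+
  then have "x' \<le> x" "x - x' \<le> 1 / real n"
    using \<open>n > 0\<close> by (simp_all add: pos_le_divide_eq)
  moreover have "0 \<le> x'" using x by (simp add: x'_def)
  moreover have "x' * real n \<in> \<int>" using \<open>n > 0\<close> by (simp add: x'_def)
  ultimately have "q \<in> grid" using x by (auto simp: q_def grid_def)
  moreover have "dist p q \<le> \<bar>x - x'\<bar> + 1 / real n"
    using sqrt_sum_squares_le_sum_abs[of "x - x'" "1 / real n"]
    by (simp add: p_eq q_def dist_Pair_Pair dist_real_def)
  then have "dist p q < r"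
    using \<open>x' \<le> x\<close> \<open>x - x' \<le> 1 / real n\<close> n by simp
  moreover have "snd q > 0" using \<open>n > 0\<close> by (simp add: q_def)
  ultimately show ?thesis by blast
qed

text \<open>
  On row \<open>m\<close> the second summand is the even number \<open>2 m\<close>, which is \<open>0\<close> on the segment because
  \<open>2/0 = 0\<close>. The codes of different rows thus fill disjoint intervals \<open>[2 m, 2 m + 1]\<close>.
\<close>

definition grid_code :: "real \<times> real \<Rightarrow> real" where
  "grid_code p = fst p + 2 / snd p"

lemma inj_on_grid_code: "inj_on grid_code grid"
proof (rule inj_onI)
  fix p q assume "p \<in> grid" "q \<in> grid" and eq: "grid_code p = grid_code q"
  then obtain x m x' m' where pq: "p = (x, 1 / real m)" "q = (x', 1 / real m')"
    and x: "0 \<le> x" "x \<le> 1" "0 \<le> x'" "x' \<le> 1"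
    by (auto simp: grid_def)
  have sum: "x + 2 * real m = x' + 2 * real m'"
    using eq by (simp add: grid_code_def pq)
  with x have "m = m'" by linarith
  with sum show "p = q" by (simp add: pq)
qed

theorem corollary1p11:
  "\<exists>(X :: real set) (d :: real \<Rightarrow> real \<Rightarrow> real) (f :: real \<Rightarrow> real).
     Metric_space X d \<and>
     compact_space (Metric_space.mtopology X d) \<and>
     homeomorphic_map (Metric_space.mtopology X d) (Metric_space.mtopology X d) f \<and>
     distal X d f \<and>
     almost_POTP X d f \<and>
     \<not> POTP X d f"
proof -
  define X where "X = grid_code ` grid"
  define g where "g = inv_into grid grid_code"
  define d where "d s t = dist (g s) (g t)" for s t
  have g_code: "g (grid_code p) = p" if "p \<in> grid" for p
    using that inj_on_grid_code by (simp add: g_def)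
  have image: "g ` X = grid" using g_code by (force simp: X_def)
  have inj: "inj_on g X" by (auto simp: X_def g_code inj_on_def)
  have d_eq: "d = (\<lambda>s t. dist (g s) (g t))" by (simp add: d_def fun_eq_iff)
  interpret Metric_space X d
    unfolding d_eq by (rule Metric_space_pullback[OF inj])
  have "compact_space mtopology"
    using compact_space_pullback[OF inj] compact_grid by (simp add: d_eq image)
  moreover have "almost_POTP X d id"
  proof -
    have shadowable: "s \<in> shadowable_points X d id" if s: "s \<in> X" "snd (g s) > 0" for s
    proof -
      obtain r where "r > 0" and r: "\<And>q. q \<in> grid \<Longrightarrow> dist (g s) q \<le> r \<Longrightarrow> q = g s"
        using grid_isolated[of "g s"] s image by blast
      show ?thesis
      proof (rule isolated_imp_shadowable_id[OF s(1) \<open>r > 0\<close>])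
        fix t assume t: "t \<in> X" "d s t \<le> r"
        have "g t \<in> grid" using t image by blast
        then have "g t = g s" using r t by (simp add: d_def)
        then show "t = s" using inj t s by (auto dest: inj_onD)
      qed
    qed
    have "\<exists>t \<in> shadowable_points X d id. t \<in> mball s r" if s: "s \<in> X" and "r > 0" for s r
    proof -
      obtain q where q: "q \<in> grid" "snd q > 0" "dist (g s) q < r"
        using grid_positive_height_dense[of "g s" r] s \<open>r > 0\<close> image by blast
      then have "grid_code q \<in> X" "g (grid_code q) = q" by (auto simp: X_def g_code)
      then show ?thesis
        using shadowable[of "grid_code q"] q s by (auto simp: d_def intro!: bexI[of _ "grid_code q"])
    qed
    then show ?thesis by (auto simp: almost_POTP_def metric_closure_of)
  qed
  moreover have "\<not> POTP X d id"
  proof (rule path_imp_not_POTP_id)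
    have segment: "(t, 0) \<in> grid" if "t \<in> {0..1}" for t
      using that by (auto simp: grid_def intro!: exI[of _ "0::nat"])
    \<comment> \<open>The code of the point \<open>(t, 0)\<close> of the segment is \<open>t\<close> itself.\<close>
    have code: "t \<in> X" "g t = (t, 0)" if "t \<in> {0..1}" for t
      using segment[OF that] g_code[OF segment[OF that]]
      by (auto simp: X_def grid_code_def intro!: image_eqI[of _ _ "(t, 0)"])
    show "(\<lambda>t. t) ` {0..1} \<subseteq> X" using code by auto
    show "\<exists>\<eta>>0. \<forall>s\<in>{0..1}. \<forall>t\<in>{0..1}. \<bar>s - t\<bar> \<le> \<eta> \<longrightarrow> d s t \<le> \<delta>" if "\<delta> > 0" for \<delta>
      using that by (intro exI[of _ \<delta>]) (auto simp: d_def code dist_Pair_Pair dist_real_def)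
  qed simp
  ultimately show ?thesis
    using Metric_space_axioms distal_id by (intro exI[of _ X] exI[of _ d] exI[of _ id]) simp
qed

end
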